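(* Let $K$ be a field of characteristic $p>0$ and $K[x]=K[x_1,\ldots,x_n]$. Let $D=\sum_{q=1}^n f_q(x_{q+1},\ldots,x_n)\partial_q$ be a derivation of $K[x]$, where $f_q(x_{q+1},\ldots,x_n)\in K[x_{q+1},\ldots,x_n]$ for $1\leq q\leq n-1$ and $f_n\in K$. Then $\operatorname{Im}D$ is a Mathieu-Zhao space of $K[x]$ if and only if $D=0$.
   Context: $\partial_q=\frac{\partial}{\partial x_q}$, and $\operatorname{Im}D=D(K[x])$. A $K$-subspace $M$ of $K[x]$ is a Mathieu-Zhao space of $K[x]$ if for any $a,b\in K[x]$ with $a^m\in M$ for all $m\geq 1$, one has $ba^m\in M$ for all sufficiently large $m$. *)

theory Defs
  imports "HOL-Library.Poly_Mapping" "HOL-Computational_Algebra.Computational_Algebra"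
begin

(* Polynomials in variables indexed by nat, as finitely supported coefficient functions on
   monomials; a monomial is the finitely supported function giving the exponent of each variable.
   The ring structure (convolution product) is the library's. *)
type_synonym 'k mpoly = "(nat \<Rightarrow>\<^sub>0 nat) \<Rightarrow>\<^sub>0 'k"

definition mpoly_const :: "'k::zero \<Rightarrow> 'k mpoly" where
  "mpoly_const c = Poly_Mapping.single 0 c"

(* K[x_i | i \<in> I] as a subset of the polynomials in all variables *)
definition mpoly_ring :: "nat set \<Rightarrow> 'k::zero mpoly set" where
  "mpoly_ring I = {P. \<forall>m\<in>Poly_Mapping.keys P. Poly_Mapping.keys m \<subseteq> I}"

definition mpoly_scale :: "'k::semiring_0 \<Rightarrow> 'k mpoly \<Rightarrow> 'k mpoly" where
  "mpoly_scale c P = mpoly_const c * P"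

(* The exponent subtraction truncates only where the factor of_nat is 0. *)
definition mpoly_pderiv :: "nat \<Rightarrow> 'k::semiring_1 mpoly \<Rightarrow> 'k mpoly" where
  "mpoly_pderiv q P = (\<Sum>m\<in>Poly_Mapping.keys P.
     Poly_Mapping.single (m - Poly_Mapping.single q 1)
       (of_nat (Poly_Mapping.lookup m q) * Poly_Mapping.lookup P m))"

global_interpretation mpoly: vector_space "mpoly_scale :: 'k::field \<Rightarrow> 'k mpoly \<Rightarrow> 'k mpoly"
  by unfold_locales
    (simp_all add: mpoly_scale_def mpoly_const_def algebra_simps single_add mult_single
      flip: mult.assoc)

definition mathieu_zhao :: "'k::field mpoly set \<Rightarrow> 'k mpoly set \<Rightarrow> bool" where
  "mathieu_zhao R M \<longleftrightarrow> M \<subseteq> R \<and> mpoly.subspace M \<and>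
     (\<forall>a\<in>R. \<forall>b\<in>R. (\<forall>m\<ge>1. a ^ m \<in> M) \<longrightarrow> (\<forall>\<^sub>F m in sequentially. b * a ^ m \<in> M))"

end

theory Submission
  imports Defs
begin

text \<open>
  A nonzero triangular derivation fails the Mathieu-Zhao condition because of one monomial.  Let
  \<open>q\<close> be the largest index with \<open>g = f q\<close> nonzero.  The polynomial \<open>g\<close> involves only variables
  beyond \<open>q\<close>, on which \<open>D\<close> vanishes, so \<open>D (g ^ (m - 1) * x\<^sub>q) = g ^ m\<close>: every positive power
  of \<open>g\<close> lies in the image of \<open>D\<close>.  A Mathieu-Zhao image would therefore contain \<open>b * g ^ m\<close>
  for each polynomial \<open>b\<close> and all large \<open>m\<close>.

  On the other hand, a monomial of \<open>\<partial>\<^sub>i P\<close> never has an exponent of \<open>x\<^sub>i\<close> congruent to \<open>-1\<close>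
  modulo the characteristic \<open>p\<close>, and multiplication by \<open>f i\<close>, which is free of \<open>x\<^sub>i\<close>, does not change that exponent.
  Hence no monomial in the image of \<open>D\<close> has all its exponents of \<open>x\<^sub>1, \<dots>, x\<^sub>q\<close> equal to
  \<open>p - 1\<close>.  With \<open>b = (x\<^sub>1 \<dots> x\<^sub>q) ^ (p - 1)\<close>, however, all monomials of the nonzero polynomial
  \<open>b * g ^ m\<close> are of this kind, so that \<open>b * g ^ m\<close> is not in the image for any \<open>m\<close>.

  Conversely, the image of the zero derivation is \<open>{0}\<close>, and in \<open>K[x]\<close> a power is zero only if
  its base is.
\<close>

lemma mpoly_ring_mult:
  fixes P Q :: "'k::semiring_0 mpoly"
  assumes "P \<in> mpoly_ring I" "Q \<in> mpoly_ring I"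
  shows "P * Q \<in> mpoly_ring I"
proof -
  have "Poly_Mapping.keys m \<subseteq> I" if "m \<in> Poly_Mapping.keys (P * Q)" for m
  proof -
    from that obtain a b where "a \<in> Poly_Mapping.keys P" "b \<in> Poly_Mapping.keys Q" "m = a + b"
      using keys_mult by blast
    then show ?thesis
      using assms Poly_Mapping.keys_add[of a b] by (fastforce simp: mpoly_ring_def)
  qed
  then show ?thesis by (simp add: mpoly_ring_def)
qed

lemma mpoly_ring_power:
  fixes P :: "'k::semiring_1 mpoly"
  assumes "P \<in> mpoly_ring I"
  shows "P ^ m \<in> mpoly_ring I"
proof (induction m)
  case 0
  show ?case by (simp add: mpoly_ring_def)
next
  case (Suc m)
  then show ?case using assms by (simp add: mpoly_ring_mult)
qed

lemma mpoly_ring_mono: "I \<subseteq> J \<Longrightarrow> mpoly_ring I \<subseteq> mpoly_ring J"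
  by (auto simp: mpoly_ring_def)

lemma lookup_eq_0_if_mpoly_ring:
  assumes "P \<in> mpoly_ring I" "m \<in> Poly_Mapping.keys P" "i \<notin> I"
  shows "Poly_Mapping.lookup m i = 0"
  using assms by (fastforce simp: mpoly_ring_def in_keys_iff)

lemma lookup_mpoly_pderiv:
  fixes P :: "'k::semiring_1 mpoly"
  shows "Poly_Mapping.lookup (mpoly_pderiv q P) m =
    of_nat (Suc (Poly_Mapping.lookup m q)) * Poly_Mapping.lookup P (m + Poly_Mapping.single q 1)"
proof -
  let ?x = "Poly_Mapping.single q (1::nat)"
  let ?c = "\<lambda>k. of_nat (Poly_Mapping.lookup k q) * Poly_Mapping.lookup P k"
  \<comment> \<open>Truncation of \<open>k - ?x\<close> is harmless, since \<open>?c k = 0\<close> when \<open>x\<^sub>q\<close> does not divide \<open>k\<close>.\<close>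
  have shift: "(?c k when k - ?x = m) = (?c k when k = m + ?x)" for k
  proof (cases "Poly_Mapping.lookup k q = 0")
    case False
    then have "k - ?x + ?x = k"
      by (intro poly_mapping_eqI) (auto simp: lookup_add lookup_minus lookup_single when_def)
    then have "k - ?x = m \<longleftrightarrow> k = m + ?x" by auto
    then show ?thesis by simp
  qed simp
  have "Poly_Mapping.lookup (mpoly_pderiv q P) m =
      (\<Sum>k\<in>Poly_Mapping.keys P. ?c k when k - ?x = m)"
    by (simp add: mpoly_pderiv_def lookup_sum lookup_single)
  also have "\<dots> = (\<Sum>k\<in>Poly_Mapping.keys P. if k = m + ?x then ?c k else 0)"
    unfolding shift by (simp add: when_def)
  also have "\<dots> = ?c (m + ?x)"
    by (simp add: in_keys_iff)
  finally show ?thesis by (simp add: lookup_add)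
qed

lemma mpoly_pderiv_eq_0:
  fixes P :: "'k::semiring_1 mpoly"
  assumes "P \<in> mpoly_ring I" "q \<notin> I"
  shows "mpoly_pderiv q P = 0"
  using assms by (simp add: mpoly_pderiv_def lookup_eq_0_if_mpoly_ring)

lemma lookup_mult_single_add:
  fixes P :: "'k::semiring_0 mpoly"
  shows "Poly_Mapping.lookup (P * Poly_Mapping.single s c) (m + s) = Poly_Mapping.lookup P m * c"
proof -
  have inner: "(\<Sum>u. Poly_Mapping.lookup (Poly_Mapping.single s c) u when m + s = l + u)
      = (c when l = m)" for l
  proof -
    have "(Poly_Mapping.lookup (Poly_Mapping.single s c) u when m + s = l + u)
        = ((c when l = m) when u = s)" for u
      by (auto simp: lookup_single when_def)
    then show ?thesis by simp
  qed
  show ?thesis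
    by (simp add: lookup_mult inner mult_when)
qed

lemma mpoly_pderiv_mult_var:
  fixes P :: "'k::semiring_1 mpoly"
  assumes "P \<in> mpoly_ring I" "q \<notin> I"
  shows "mpoly_pderiv q (P * Poly_Mapping.single (Poly_Mapping.single q 1) 1) = P"
proof (rule poly_mapping_eqI)
  fix m
  let ?x = "Poly_Mapping.single q (1::nat)"
  have "Poly_Mapping.lookup (P * Poly_Mapping.single ?x 1) (m + ?x) = Poly_Mapping.lookup P m"
    using lookup_mult_single_add[of P ?x 1 m] by simp
  then show "Poly_Mapping.lookup (mpoly_pderiv q (P * Poly_Mapping.single ?x 1)) m
      = Poly_Mapping.lookup P m"
    using lookup_eq_0_if_mpoly_ring[OF assms(1) _ assms(2), of m]
    by (cases "m \<in> Poly_Mapping.keys P") (simp_all add: lookup_mpoly_pderiv in_keys_iff)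
qed

text \<open>The factor \<open>of_nat (Suc j)\<close> that differentiation puts on \<open>x\<^sub>q ^ j\<close> is zero exactly if
  \<open>j\<close> is \<open>-1\<close> modulo the characteristic; a coefficient free of \<open>x\<^sub>q\<close> leaves \<open>j\<close> as it is.\<close>
lemma exponent_in_mult_mpoly_pderiv:
  fixes h P :: "'k::semiring_1 mpoly"
  assumes "h \<in> mpoly_ring I" "q \<notin> I" "m \<in> Poly_Mapping.keys (h * mpoly_pderiv q P)"
  shows "of_nat (Suc (Poly_Mapping.lookup m q)) \<noteq> (0::'k)"
proof -
  obtain a b where ab: "a \<in> Poly_Mapping.keys h" "b \<in> Poly_Mapping.keys (mpoly_pderiv q P)"
      "m = a + b"
    using assms(3) keys_mult by blast
  have "Poly_Mapping.lookup m q = Poly_Mapping.lookup b q"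
    using lookup_eq_0_if_mpoly_ring[OF assms(1) ab(1) assms(2)] ab(3) by (simp add: lookup_add)
  moreover have "of_nat (Suc (Poly_Mapping.lookup b q)) \<noteq> (0::'k)"
    using ab(2) by (auto simp: in_keys_iff lookup_mpoly_pderiv simp del: of_nat_Suc)
  ultimately show ?thesis by simp
qed

theorem proposition2p8:
  fixes n :: nat and f :: "nat \<Rightarrow> 'k::field mpoly" and D :: "'k mpoly \<Rightarrow> 'k mpoly"
  assumes "CHAR('k) > 0"
    and "n \<ge> 1"
    and "\<And>q. 1 \<le> q \<Longrightarrow> q \<le> n - 1 \<Longrightarrow> f q \<in> mpoly_ring {q+1..n}"
    and "f n \<in> range mpoly_const"
    and "\<And>P. P \<in> mpoly_ring {1..n} \<Longrightarrow> D P = (\<Sum>q=1..n. f q * mpoly_pderiv q P)"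
  shows "mathieu_zhao (mpoly_ring {1..n}) (D ` mpoly_ring {1..n}) \<longleftrightarrow>
    (\<forall>P\<in>mpoly_ring {1..n}. D P = 0)"
proof
  let ?R = "mpoly_ring {1..n} :: 'k mpoly set"
  assume zero: "\<forall>P\<in>?R. D P = 0"
  have "0 \<in> ?R" by (simp add: mpoly_ring_def)
  with zero have "D ` ?R = {0}" by force
  moreover have "b * a ^ m = 0" if "\<forall>m\<ge>1. a ^ m = 0" "m \<ge> 1" for a b :: "'k mpoly" and m :: nat
    using that by fastforce
  ultimately show "mathieu_zhao ?R (D ` ?R)"
    using \<open>0 \<in> ?R\<close> by (auto simp: mathieu_zhao_def eventually_sequentially mpoly.subspace_single_0)
next
  let ?R = "mpoly_ring {1..n} :: 'k mpoly set"
  assume mz: "mathieu_zhao ?R (D ` ?R)"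
  have triangular: "f i \<in> mpoly_ring {i+1..n}" if "i \<in> {1..n}" for i
  proof (cases "i = n")
    case True
    \<comment> \<open>Here \<open>{i+1..n}\<close> is empty, which expresses that \<open>f n\<close> is a constant.\<close>
    then show ?thesis
      using assms(4) by (auto simp: mpoly_ring_def mpoly_const_def split: if_splits)
  next
    case False
    then show ?thesis using that by (intro assms(3)) auto
  qed
  show "\<forall>P\<in>?R. D P = 0"
  proof (rule ccontr)
    assume "\<not> (\<forall>P\<in>?R. D P = 0)"
    then obtain P where "P \<in> ?R" "D P \<noteq> 0" by blast
    then have "\<exists>i\<in>{1..n}. f i \<noteq> 0"
      using assms(5) by (metis (no_types, lifting) mult_zero_left sum.neutral)
    then have "{i\<in>{1..n}. f i \<noteq> 0} \<noteq> {}" by blast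
    moreover define q where "q = Max {i\<in>{1..n}. f i \<noteq> 0}"
    ultimately have "q \<in> {i\<in>{1..n}. f i \<noteq> 0}"
      unfolding q_def by (intro Max_in) auto
    then have q: "q \<in> {1..n}" "f q \<noteq> 0" by auto
    have above: "i \<le> q" if "i \<in> {1..n}" "f i \<noteq> 0" for i
      unfolding q_def using that by (intro Max_ge) auto
    have g_R: "f q \<in> ?R"
      using triangular[OF q(1)] mpoly_ring_mono[of "{q+1..n}" "{1..n}"] by auto

    have powers: "f q ^ m \<in> D ` ?R" if "m \<ge> 1" for m
    proof -
      let ?h = "f q ^ (m - 1)"
      let ?x = "Poly_Mapping.single (Poly_Mapping.single q 1) 1 :: 'k mpoly"
      have h: "?h \<in> mpoly_ring {q+1..n}"
        by (intro mpoly_ring_power triangular q)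
      have x: "?x \<in> mpoly_ring {q}" by (simp add: mpoly_ring_def)
      have hx: "?h * ?x \<in> mpoly_ring {q..n}"
        using h x q(1) mpoly_ring_mono[of "{q+1..n}" "{q..n}"] mpoly_ring_mono[of "{q}" "{q..n}"]
        by (intro mpoly_ring_mult) auto
      then have hx_R: "?h * ?x \<in> ?R"
        using q(1) mpoly_ring_mono[of "{q..n}" "{1..n}"] by auto
      have "f i * mpoly_pderiv i (?h * ?x) = 0" if "i \<in> {1..n} - {q}" for i
      proof (cases "i < q")
        case True
        then show ?thesis using mpoly_pderiv_eq_0[OF hx, of i] by simp
      next
        case False
        then have "f i = 0" using above[of i] that by force
        then show ?thesis by simp
      qed
      then have "(\<Sum>i=1..n. f i * mpoly_pderiv i (?h * ?x)) = f q * mpoly_pderiv q (?h * ?x)"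
        using q(1) by (subst sum.remove[of _ q]) (auto intro!: sum.neutral simp del: mult_eq_0_iff)
      then have "D (?h * ?x) = f q * mpoly_pderiv q (?h * ?x)"
        using assms(5)[OF hx_R] by simp
      also have "\<dots> = f q * ?h"
        using mpoly_pderiv_mult_var[OF h, of q] by simp
      also have "\<dots> = f q ^ m"
        using that by (simp add: power_eq_if)
      finally show ?thesis using hx_R by (metis image_eqI)
    qed

    define e where "e = (\<Sum>i=1..q. Poly_Mapping.single i (CHAR('k) - 1))"
    define b where "b = (Poly_Mapping.single e 1 :: 'k mpoly)"
    have lookup_e: "Poly_Mapping.lookup e i = (if i \<in> {1..q} then CHAR('k) - 1 else 0)" for i
      by (simp add: e_def lookup_sum lookup_single when_def)
    have b_R: "b \<in> ?R"
      using q(1) by (auto simp: b_def mpoly_ring_def in_keys_iff lookup_e split: if_splits)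

    have "b * f q ^ m \<notin> D ` ?R" for m
    proof
      assume "b * f q ^ m \<in> D ` ?R"
      then obtain P where P: "b * f q ^ m = (\<Sum>i=1..n. f i * mpoly_pderiv i P)"
        using assms(5) by auto
      have "b \<noteq> 0"
        by (metis b_def lookup_single_eq lookup_zero zero_neq_one)
      then have "b * f q ^ m \<noteq> 0"
        using q(2) by simp
      then obtain k where k: "k \<in> Poly_Mapping.keys (b * f q ^ m)"
        by fastforce
      then obtain k' where k': "k' \<in> Poly_Mapping.keys (f q ^ m)" "k = e + k'"
        using keys_mult[of b "f q ^ m"] by (auto simp: b_def)
      have "k \<in> (\<Union>i\<in>{1..n}. Poly_Mapping.keys (f i * mpoly_pderiv i P))"
        using k keys_sum[of "\<lambda>i. f i * mpoly_pderiv i P" "{1..n}"] unfolding P by blast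
      then obtain i where i: "i \<in> {1..n}" "k \<in> Poly_Mapping.keys (f i * mpoly_pderiv i P)"
        by blast
      then have "i \<le> q" using above by fastforce
      then have "Poly_Mapping.lookup k' i = 0"
        using lookup_eq_0_if_mpoly_ring[OF mpoly_ring_power[OF triangular[OF q(1)]] k'(1)] by simp
      then have "Suc (Poly_Mapping.lookup k i) = CHAR('k)"
        using \<open>i \<le> q\<close> i(1) assms(1) by (simp add: k'(2) lookup_add lookup_e)
      then show False
        using exponent_in_mult_mpoly_pderiv[OF triangular[OF i(1)] _ i(2)] by simp
    qed
    moreover have "\<forall>\<^sub>F m in sequentially. b * f q ^ m \<in> D ` ?R"
      using mz g_R b_R powers by (simp add: mathieu_zhao_def)
    ultimately show False by simp
  qed
qed

end
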